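(* Let $\mathsf{M}$ be a model category with class of weak equivalences $W$. Then the Quillen homotopy category $\mathsf{Ho}(\mathsf{M})$, with its localization functor $\gamma_{\mathsf M}:\mathsf{M}\to\mathsf{Ho}(\mathsf{M})$, is a strict localization $\mathsf{M}[[W^{-1}]]$ of $\mathsf{M}$ at $W$.
   Context: All model categories are assumed to admit functorial factorizations. A strong localization of a category $\mathsf{C}$ at a family $W$ of morphisms is a category $\mathsf{C}[[W^{-1}]]$ with a functor $L:\mathsf{C}\to\mathsf{C}[[W^{-1}]]$ sending morphisms in $W$ to isomorphisms such that: (L1') for every category $\mathsf{D}$ and functor $F:\mathsf{C}\to\mathsf{D}$ sending morphisms in $W$ to isomorphisms there is a unique functor $\bar F:\mathsf{C}[[W^{-1}]]\to\mathsf{D}$ with $F=\bar F\circ L$ (strict equality). A strict localization of a category $\mathsf{C}$ at a family $W$ of morphisms is a pair $(\mathsf{C}[[W^{-1}]],L)$ consisting of a category $\mathsf{C}[[W^{-1}]]$ and a functor $L:\mathsf{C}\to\mathsf{C}[[W^{-1}]]$ sending morphisms in $W$ to isomorphisms, satisfying (L1') for every category $\mathsf{D}$ and functor $F:\mathsf{C}\to\mathsf{D}$ sending morphisms in $W$ to isomorphisms there is a unique functor $\bar F:\mathsf{C}[[W^{-1}]]\to\mathsf{D}$ with $F=\bar F\circ L$ (strict equality), and (L2'): for every category $\mathsf{D}$ the functor $-\circ L:\mathrm{Fun}(\mathsf{C}[[W^{-1}]],\mathsf{D})\to\mathrm{Fun}(\mathsf{C},\mathsf{D})$ is fully faithful.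 The Quillen homotopy category $(\mathsf{Ho}(\mathsf{M}),\gamma_{\mathsf M})$ is the strong localization of $\mathsf{M}$ at $W$; it exists and is unique up to unique isomorphism. It can be described as having the objects of $\mathsf{M}$, with morphisms the classes of finite zigzag strings of morphisms of $\mathsf{M}$ and formal reversals $w^{-1}$ of weak equivalences $w$, modulo the identifications of empty strings with identities, of concatenations of composable $\mathsf{M}$-maps with their composites, and of $w,w^{-1}$ and $w^{-1},w$ with identities; $\gamma_{\mathsf M}X=X$ and $\gamma_{\mathsf M}f=[f]$. *)

theory Defs
  imports Main "HOL-Library.FuncSet"
begin

section \<open>Categories, functors, natural transformations\<close>

record ('o, 'm) cat =
  Obj :: "'o set"
  Arr :: "'m set"
  Dom :: "'m \<Rightarrow> 'o"
  Cod :: "'m \<Rightarrow> 'o"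
  Ident :: "'o \<Rightarrow> 'm"
  Comp :: "'m \<Rightarrow> 'm \<Rightarrow> 'm"

text \<open>\<^term>\<open>Comp C g f\<close> is the composite ``g after f''; its value is only relevant if
  \<^term>\<open>Cod C f = Dom C g\<close>.\<close>

definition hom :: "('o, 'm) cat \<Rightarrow> 'o \<Rightarrow> 'o \<Rightarrow> 'm set" where
  "hom C x y = {f \<in> Arr C. Dom C f = x \<and> Cod C f = y}"

locale category =
  fixes C :: "('o, 'm) cat"
  assumes Dom_in_Obj: "f \<in> Arr C \<Longrightarrow> Dom C f \<in> Obj C"
    and Cod_in_Obj: "f \<in> Arr C \<Longrightarrow> Cod C f \<in> Obj C"
    and Ident_in_hom: "x \<in> Obj C \<Longrightarrow> Ident C x \<in> hom C x x"
    and Comp_in_hom: "f \<in> hom C x y \<Longrightarrow> g \<in> hom C y z \<Longrightarrow> Comp C g f \<in> hom C x z"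
    and Comp_Ident_left: "f \<in> hom C x y \<Longrightarrow> Comp C (Ident C y) f = f"
    and Comp_Ident_right: "f \<in> hom C x y \<Longrightarrow> Comp C f (Ident C x) = f"
    and Comp_assoc: "f \<in> hom C x y \<Longrightarrow> g \<in> hom C y z \<Longrightarrow> h \<in> hom C z w \<Longrightarrow>
      Comp C h (Comp C g f) = Comp C (Comp C h g) f"

definition is_iso :: "('o, 'm) cat \<Rightarrow> 'm \<Rightarrow> bool" where
  "is_iso C f \<longleftrightarrow> f \<in> Arr C \<and>
    (\<exists>g \<in> hom C (Cod C f) (Dom C f).
       Comp C g f = Ident C (Dom C f) \<and> Comp C f g = Ident C (Cod C f))"

text \<open>The object and arrow maps of a functor, and the component map of a natural transformation,
  are required to be extensional (undefined outside the carrier), so that HOL equality of functors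
  and of natural transformations is strict equality.\<close>

record ('o, 'm, 'p, 'n) ftor =
  FObj :: "'o \<Rightarrow> 'p"
  FArr :: "'m \<Rightarrow> 'n"

definition is_functor ::
  "('o, 'm) cat \<Rightarrow> ('p, 'n) cat \<Rightarrow> ('o, 'm, 'p, 'n) ftor \<Rightarrow> bool" where
  "is_functor C D F \<longleftrightarrow>
    FObj F \<in> Obj C \<rightarrow>\<^sub>E Obj D \<and>
    FArr F \<in> Arr C \<rightarrow>\<^sub>E Arr D \<and>
    (\<forall>f \<in> Arr C. Dom D (FArr F f) = FObj F (Dom C f) \<and> Cod D (FArr F f) = FObj F (Cod C f)) \<and>
    (\<forall>x \<in> Obj C. FArr F (Ident C x) = Ident D (FObj F x)) \<and>
    (\<forall>f \<in> Arr C. \<forall>g \<in> Arr C. Cod C f = Dom C g \<longrightarrow>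
       FArr F (Comp C g f) = Comp D (FArr F g) (FArr F f))"

definition comp_functor ::
  "('o, 'm) cat \<Rightarrow> ('p, 'n, 'q, 'k) ftor \<Rightarrow> ('o, 'm, 'p, 'n) ftor \<Rightarrow> ('o, 'm, 'q, 'k) ftor" where
  "comp_functor C G F =
    \<lparr>FObj = compose (Obj C) (FObj G) (FObj F), FArr = compose (Arr C) (FArr G) (FArr F)\<rparr>"

definition fully_faithful ::
  "('o, 'm) cat \<Rightarrow> ('p, 'n) cat \<Rightarrow> ('o, 'm, 'p, 'n) ftor \<Rightarrow> bool" where
  "fully_faithful C D F \<longleftrightarrow>
    (\<forall>x \<in> Obj C. \<forall>y \<in> Obj C. bij_betw (FArr F) (hom C x y) (hom D (FObj F x) (FObj F y)))"

record ('o, 'm, 'p, 'n) nattrans =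
  NDom :: "('o, 'm, 'p, 'n) ftor"
  NCod :: "('o, 'm, 'p, 'n) ftor"
  NComp :: "'o \<Rightarrow> 'n"

definition is_nattrans ::
  "('o, 'm) cat \<Rightarrow> ('p, 'n) cat \<Rightarrow> ('o, 'm, 'p, 'n) nattrans \<Rightarrow> bool" where
  "is_nattrans C D t \<longleftrightarrow>
    is_functor C D (NDom t) \<and> is_functor C D (NCod t) \<and>
    NComp t \<in> extensional (Obj C) \<and>
    (\<forall>x \<in> Obj C. NComp t x \<in> hom D (FObj (NDom t) x) (FObj (NCod t) x)) \<and>
    (\<forall>f \<in> Arr C. Comp D (NComp t (Cod C f)) (FArr (NDom t) f) =
                  Comp D (FArr (NCod t) f) (NComp t (Dom C f)))"

definition Fun_cat ::
  "('o, 'm) cat \<Rightarrow> ('p, 'n) cat \<Rightarrow> (('o, 'm, 'p, 'n) ftor, ('o, 'm, 'p, 'n) nattrans) cat" where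
  "Fun_cat C D =
    \<lparr>Obj = {F. is_functor C D F},
     Arr = {t. is_nattrans C D t},
     Dom = NDom,
     Cod = NCod,
     Ident = (\<lambda>F. \<lparr>NDom = F, NCod = F, NComp = (\<lambda>x \<in> Obj C. Ident D (FObj F x))\<rparr>),
     Comp = (\<lambda>s t. \<lparr>NDom = NDom t, NCod = NCod s,
                     NComp = (\<lambda>x \<in> Obj C. Comp D (NComp s x) (NComp t x))\<rparr>)\<rparr>"

text \<open>For \<open>L : C \<rightarrow> B\<close>, the functor \<open>- \<circ> L : Fun(B, D) \<rightarrow> Fun(C, D)\<close>.\<close>

definition precomp_functor ::
  "('o, 'm) cat \<Rightarrow> ('p, 'n) cat \<Rightarrow> ('q, 'k) cat \<Rightarrow> ('o, 'm, 'p, 'n) ftor \<Rightarrow>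
   (('p, 'n, 'q, 'k) ftor, ('p, 'n, 'q, 'k) nattrans,
    ('o, 'm, 'q, 'k) ftor, ('o, 'm, 'q, 'k) nattrans) ftor" where
  "precomp_functor C B D L =
    \<lparr>FObj = (\<lambda>F \<in> Obj (Fun_cat B D). comp_functor C F L),
     FArr = (\<lambda>t \<in> Arr (Fun_cat B D).
       \<lparr>NDom = comp_functor C (NDom t) L, NCod = comp_functor C (NCod t) L,
        NComp = compose (Obj C) (NComp t) (FObj L)\<rparr>)\<rparr>"


section \<open>Strong and strict localizations\<close>

text \<open>The test categories of the universal properties range over all categories on the types given
  by the two type arguments; a statement that is polymorphic in these two types is therefore a
  statement about all test categories.\<close>

definition strong_localization ::
  "'d itself \<Rightarrow> 'e itself \<Rightarrow> ('o, 'm) cat \<Rightarrow> 'm set \<Rightarrow> ('p, 'n) cat \<Rightarrow>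
   ('o, 'm, 'p, 'n) ftor \<Rightarrow> bool" where
  "strong_localization _ _ C W H L \<longleftrightarrow>
    category C \<and> W \<subseteq> Arr C \<and> category H \<and> is_functor C H L \<and>
    (\<forall>w \<in> W. is_iso H (FArr L w)) \<and>
    (\<forall>(D :: ('d, 'e) cat) F. category D \<and> is_functor C D F \<and> (\<forall>w \<in> W. is_iso D (FArr F w)) \<longrightarrow>
       (\<exists>!G. is_functor H D G \<and> F = comp_functor C G L))"

definition strict_localization ::
  "'d itself \<Rightarrow> 'e itself \<Rightarrow> ('o, 'm) cat \<Rightarrow> 'm set \<Rightarrow> ('p, 'n) cat \<Rightarrow>
   ('o, 'm, 'p, 'n) ftor \<Rightarrow> bool" where
  "strict_localization d e C W H L \<longleftrightarrow>
    strong_localization d e C W H L \<and>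
    (\<forall>D :: ('d, 'e) cat. category D \<longrightarrow>
       fully_faithful (Fun_cat H D) (Fun_cat C D) (precomp_functor C H D L))"


section \<open>Finite limits and colimits\<close>

definition const_functor :: "('i, 'j) cat \<Rightarrow> ('o, 'm) cat \<Rightarrow> 'o \<Rightarrow> ('i, 'j, 'o, 'm) ftor" where
  "const_functor J C x =
    \<lparr>FObj = (\<lambda>i \<in> Obj J. x), FArr = (\<lambda>a \<in> Arr J. Ident C x)\<rparr>"

definition is_cone ::
  "('i, 'j) cat \<Rightarrow> ('o, 'm) cat \<Rightarrow> ('i, 'j, 'o, 'm) ftor \<Rightarrow> 'o \<Rightarrow> ('i, 'j, 'o, 'm) nattrans \<Rightarrow> bool"
  where
  "is_cone J C X x t \<longleftrightarrow>
    x \<in> Obj C \<and> is_nattrans J C t \<and> NDom t = const_functor J C x \<and> NCod t = X"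

definition is_cocone ::
  "('i, 'j) cat \<Rightarrow> ('o, 'm) cat \<Rightarrow> ('i, 'j, 'o, 'm) ftor \<Rightarrow> 'o \<Rightarrow> ('i, 'j, 'o, 'm) nattrans \<Rightarrow> bool"
  where
  "is_cocone J C X x t \<longleftrightarrow>
    x \<in> Obj C \<and> is_nattrans J C t \<and> NDom t = X \<and> NCod t = const_functor J C x"

definition has_limit ::
  "('i, 'j) cat \<Rightarrow> ('o, 'm) cat \<Rightarrow> ('i, 'j, 'o, 'm) ftor \<Rightarrow> bool" where
  "has_limit J C X \<longleftrightarrow>
    (\<exists>x t. is_cone J C X x t \<and>
      (\<forall>y s. is_cone J C X y s \<longrightarrow>
        (\<exists>!u. u \<in> hom C y x \<and> (\<forall>i \<in> Obj J. Comp C (NComp t i) u = NComp s i))))"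

definition has_colimit ::
  "('i, 'j) cat \<Rightarrow> ('o, 'm) cat \<Rightarrow> ('i, 'j, 'o, 'm) ftor \<Rightarrow> bool" where
  "has_colimit J C X \<longleftrightarrow>
    (\<exists>x t. is_cocone J C X x t \<and>
      (\<forall>y s. is_cocone J C X y s \<longrightarrow>
        (\<exists>!u. u \<in> hom C x y \<and> (\<forall>i \<in> Obj J. Comp C u (NComp t i) = NComp s i))))"

text \<open>Every finite category is isomorphic to one whose objects and arrows are natural numbers.\<close>

definition has_finite_limits_colimits :: "('o, 'm) cat \<Rightarrow> bool" where
  "has_finite_limits_colimits C \<longleftrightarrow>
    (\<forall>(J :: (nat, nat) cat) X.
       category J \<and> finite (Obj J) \<and> finite (Arr J) \<and> is_functor J C X \<longrightarrow>
       has_limit J C X \<and> has_colimit J C X)"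


section \<open>Model categories\<close>

text \<open>An arrow \<open>(f, g, u, v)\<close> of the arrow category is the commutative square from \<open>f\<close> to \<open>g\<close>
  with top side \<open>u\<close> and bottom side \<open>v\<close>.\<close>

definition arrow_category :: "('o, 'm) cat \<Rightarrow> ('m, 'm \<times> 'm \<times> 'm \<times> 'm) cat" where
  "arrow_category C =
    \<lparr>Obj = Arr C,
     Arr = {(f, g, u, v). f \<in> Arr C \<and> g \<in> Arr C \<and>
              u \<in> hom C (Dom C f) (Dom C g) \<and> v \<in> hom C (Cod C f) (Cod C g) \<and>
              Comp C g u = Comp C v f},
     Dom = (\<lambda>(f, g, u, v). f),
     Cod = (\<lambda>(f, g, u, v). g),
     Ident = (\<lambda>f. (f, f, Ident C (Dom C f), Ident C (Cod C f))),
     Comp = (\<lambda>(f', g', u', v') (f, g, u, v). (f, g', Comp C u' u, Comp C v' v))\<rparr>"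

definition source_functor :: "('o, 'm) cat \<Rightarrow> ('m, 'm \<times> 'm \<times> 'm \<times> 'm, 'o, 'm) ftor" where
  "source_functor C =
    \<lparr>FObj = (\<lambda>f \<in> Arr C. Dom C f), FArr = (\<lambda>(f, g, u, v) \<in> Arr (arrow_category C). u)\<rparr>"

definition target_functor :: "('o, 'm) cat \<Rightarrow> ('m, 'm \<times> 'm \<times> 'm \<times> 'm, 'o, 'm) ftor" where
  "target_functor C =
    \<lparr>FObj = (\<lambda>f \<in> Arr C. Cod C f), FArr = (\<lambda>(f, g, u, v) \<in> Arr (arrow_category C). v)\<rparr>"

text \<open>A functorial factorization \<open>f = r f \<circ> l f\<close> with \<open>l f\<close> in \<open>A\<close> and \<open>r f\<close> in \<open>B\<close>: the middle
  object is a functor \<open>E\<close> of \<open>f\<close>, and \<open>l\<close> and \<open>r\<close> are natural in \<open>f\<close>.\<close>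

definition has_functorial_factorization :: "('o, 'm) cat \<Rightarrow> 'm set \<Rightarrow> 'm set \<Rightarrow> bool" where
  "has_functorial_factorization C A B \<longleftrightarrow>
    (\<exists>E l r. is_functor (arrow_category C) C E \<and>
       is_nattrans (arrow_category C) C l \<and> NDom l = source_functor C \<and> NCod l = E \<and>
       is_nattrans (arrow_category C) C r \<and> NDom r = E \<and> NCod r = target_functor C \<and>
       (\<forall>f \<in> Arr C. NComp l f \<in> A \<and> NComp r f \<in> B \<and> Comp C (NComp r f) (NComp l f) = f))"

definition is_retract :: "('o, 'm) cat \<Rightarrow> 'o \<Rightarrow> 'o \<Rightarrow> bool" where
  "is_retract C x y \<longleftrightarrow> (\<exists>s \<in> hom C x y. \<exists>r \<in> hom C y x. Comp C r s = Ident C x)"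

definition closed_under_retracts :: "('o, 'm) cat \<Rightarrow> 'm set \<Rightarrow> bool" where
  "closed_under_retracts C A \<longleftrightarrow>
    (\<forall>g \<in> A. \<forall>f \<in> Arr C. is_retract (arrow_category C) f g \<longrightarrow> f \<in> A)"

definition two_out_of_three :: "('o, 'm) cat \<Rightarrow> 'm set \<Rightarrow> bool" where
  "two_out_of_three C A \<longleftrightarrow>
    (\<forall>f \<in> Arr C. \<forall>g \<in> Arr C. Cod C f = Dom C g \<longrightarrow>
       (f \<in> A \<and> g \<in> A \<longrightarrow> Comp C g f \<in> A) \<and>
       (f \<in> A \<and> Comp C g f \<in> A \<longrightarrow> g \<in> A) \<and>
       (g \<in> A \<and> Comp C g f \<in> A \<longrightarrow> f \<in> A))"

definition has_lifting :: "('o, 'm) cat \<Rightarrow> 'm \<Rightarrow> 'm \<Rightarrow> bool" where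
  "has_lifting C i p \<longleftrightarrow>
    (\<forall>u \<in> hom C (Dom C i) (Dom C p). \<forall>v \<in> hom C (Cod C i) (Cod C p). Comp C p u = Comp C v i \<longrightarrow>
       (\<exists>h \<in> hom C (Cod C i) (Dom C p). Comp C h i = u \<and> Comp C p h = v))"

text \<open>Quillen's axioms, with functorial factorizations. Only finite limits and colimits are
  required, so model categories in the sense of authors who ask for all small ones are included.
  That the three classes contain the identities and are closed under composition follows from the
  retract, lifting and factorization axioms and two-out-of-three.\<close>

locale model_category = category M
  for M :: "('o, 'm) cat" +
  fixes W :: "'m set" and Cof :: "'m set" and Fib :: "'m set"
  assumes W_Arr: "W \<subseteq> Arr M"
    and Cof_Arr: "Cof \<subseteq> Arr M"
    and Fib_Arr: "Fib \<subseteq> Arr M"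
    and finite_limits_colimits: "has_finite_limits_colimits M"
    and W_two_out_of_three: "two_out_of_three M W"
    and W_retracts: "closed_under_retracts M W"
    and Cof_retracts: "closed_under_retracts M Cof"
    and Fib_retracts: "closed_under_retracts M Fib"
    and Cof_lifting: "i \<in> Cof \<Longrightarrow> p \<in> Fib \<inter> W \<Longrightarrow> has_lifting M i p"
    and trivial_Cof_lifting: "i \<in> Cof \<inter> W \<Longrightarrow> p \<in> Fib \<Longrightarrow> has_lifting M i p"
    and Cof_factorization: "has_functorial_factorization M Cof (Fib \<inter> W)"
    and trivial_Cof_factorization: "has_functorial_factorization M (Cof \<inter> W) Fib"


section \<open>The Quillen homotopy category\<close>

text \<open>\<open>Fwd f\<close> is a morphism of the model category, \<open>Rev w\<close> the formal reversal of a weak equivalence.\<close>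

datatype 'm letter = Fwd 'm | Rev 'm

text \<open>\<^term>\<open>zigzag C W x y p\<close>: the list \<open>p\<close> is a string from \<open>x\<close> to \<open>y\<close>, in diagrammatic order,
  i.e. the first letter starts at \<open>x\<close> and the last letter ends at \<open>y\<close>.\<close>

inductive zigzag :: "('o, 'm) cat \<Rightarrow> 'm set \<Rightarrow> 'o \<Rightarrow> 'o \<Rightarrow> 'm letter list \<Rightarrow> bool"
  for C :: "('o, 'm) cat" and W :: "'m set" where
  Empty: "x \<in> Obj C \<Longrightarrow> zigzag C W x x []"
| Fwd: "f \<in> Arr C \<Longrightarrow> zigzag C W (Cod C f) y p \<Longrightarrow> zigzag C W (Dom C f) y (Fwd f # p)"
| Rev: "w \<in> W \<Longrightarrow> zigzag C W (Dom C w) y p \<Longrightarrow> zigzag C W (Cod C w) y (Rev w # p)"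

inductive zigzag_eq ::
  "('o, 'm) cat \<Rightarrow> 'm set \<Rightarrow> 'o \<Rightarrow> 'o \<Rightarrow> 'm letter list \<Rightarrow> 'm letter list \<Rightarrow> bool"
  for C :: "('o, 'm) cat" and W :: "'m set" where
  refl: "zigzag C W x y p \<Longrightarrow> zigzag_eq C W x y p p"
| sym: "zigzag_eq C W x y p q \<Longrightarrow> zigzag_eq C W x y q p"
| trans: "zigzag_eq C W x y p q \<Longrightarrow> zigzag_eq C W x y q r \<Longrightarrow> zigzag_eq C W x y p r"
| cong: "zigzag C W x' x a \<Longrightarrow> zigzag_eq C W x y p q \<Longrightarrow> zigzag C W y y' b \<Longrightarrow>
    zigzag_eq C W x' y' (a @ p @ b) (a @ q @ b)"
| ident: "x \<in> Obj C \<Longrightarrow> zigzag_eq C W x x [] [Fwd (Ident C x)]"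
| comp: "f \<in> hom C x y \<Longrightarrow> g \<in> hom C y z \<Longrightarrow>
    zigzag_eq C W x z [Fwd f, Fwd g] [Fwd (Comp C g f)]"
| fwd_rev: "w \<in> W \<Longrightarrow>
    zigzag_eq C W (Dom C w) (Dom C w) [Fwd w, Rev w] [Fwd (Ident C (Dom C w))]"
| rev_fwd: "w \<in> W \<Longrightarrow>
    zigzag_eq C W (Cod C w) (Cod C w) [Rev w, Fwd w] [Fwd (Ident C (Cod C w))]"

definition zigzag_class ::
  "('o, 'm) cat \<Rightarrow> 'm set \<Rightarrow> 'o \<Rightarrow> 'o \<Rightarrow> 'm letter list \<Rightarrow> 'm letter list set" where
  "zigzag_class C W x y p = {q. zigzag_eq C W x y p q}"

text \<open>A morphism \<open>(x, c, y)\<close> is a class \<open>c\<close> of strings together with its source and target.\<close>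

definition Ho :: "('o, 'm) cat \<Rightarrow> 'm set \<Rightarrow> ('o, 'o \<times> 'm letter list set \<times> 'o) cat" where
  "Ho C W =
    \<lparr>Obj = Obj C,
     Arr = {(x, zigzag_class C W x y p, y) | x y p. zigzag C W x y p},
     Dom = (\<lambda>(x, c, y). x),
     Cod = (\<lambda>(x, c, y). y),
     Ident = (\<lambda>x. (x, zigzag_class C W x x [], x)),
     Comp = (\<lambda>(y', d, z) (x, c, y). (x, \<Union>p \<in> c. \<Union>q \<in> d. zigzag_class C W x z (p @ q), z))\<rparr>"

definition Ho_functor ::
  "('o, 'm) cat \<Rightarrow> 'm set \<Rightarrow> ('o, 'm, 'o, 'o \<times> 'm letter list set \<times> 'o) ftor" where
  "Ho_functor C W =
    \<lparr>FObj = (\<lambda>x \<in> Obj C. x),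
     FArr = (\<lambda>f \<in> Arr C. (Dom C f, zigzag_class C W (Dom C f) (Cod C f) [Fwd f], Cod C f))\<rparr>"

end

theory Submission imports Defs begin

text \<open>In the homotopy category \<open>H\<close> every morphism is a composite of images \<open>L f\<close> of arrows of the
  original category and of inverses of images \<open>L w\<close> of weak equivalences. This generation principle
  is \<open>Ho_arrow_induct\<close>. The uniqueness of extended functors and the full faithfulness of
  precomposition come down to it, because what happens at \<open>(L w)\<inverse>\<close> is forced by what happens
  at \<open>L w\<close>.

  For functors: a functor \<open>G\<close> on \<open>H\<close> must send \<open>(L w)\<inverse>\<close> to the inverse of \<open>G (L w)\<close>, so \<open>G\<close> is
  determined by \<open>G \<circ> L\<close> (\<open>functor_from_Ho_unique\<close>). Conversely, if \<open>F\<close> inverts the weak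
  equivalences, then a zigzag has a value in the target category, in which a reversed letter \<open>w\<close>
  counts as the inverse of \<open>F w\<close>. Each of the relations between zigzags holds for the values
  (\<open>zigzag_value_eq\<close>), so \<open>F\<close> extends to \<open>H\<close>.

  For transformations: \<open>L\<close> is the identity on objects, so transformations \<open>F \<Rightarrow> G\<close> and
  \<open>F \<circ> L \<Rightarrow> G \<circ> L\<close> are given by the same families of components, and only the
  naturality conditions could differ. They agree, since naturality squares can be pasted, and a
  naturality square at an invertible arrow can be turned around to give one at its inverse
  (\<open>square_inverse\<close>); thus naturality at the arrows \<open>L f\<close> spreads to all of \<open>H\<close>
  (\<open>nattrans_Ho_iff\<close>).\<close>

section \<open>Inverses, functors and transformations\<close>

definition inverse_pair :: "('o, 'm) cat \<Rightarrow> 'm \<Rightarrow> 'm \<Rightarrow> bool" where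
  "inverse_pair C f g \<longleftrightarrow> f \<in> Arr C \<and> g \<in> hom C (Cod C f) (Dom C f) \<and>
     Comp C g f = Ident C (Dom C f) \<and> Comp C f g = Ident C (Cod C f)"

lemma is_iso_iff_inverse_pair: "is_iso C f \<longleftrightarrow> (\<exists>g. inverse_pair C f g)"
  by (auto simp: is_iso_def inverse_pair_def)

lemma Arr_in_hom: "f \<in> Arr C \<Longrightarrow> f \<in> hom C (Dom C f) (Cod C f)"
  by (simp add: hom_def)

lemma (in category) inverse_pair_unique:
  assumes "inverse_pair C f g" and "inverse_pair C f h"
  shows "g = h"
proof -
  have f: "f \<in> hom C (Dom C f) (Cod C f)"
    and g: "g \<in> hom C (Cod C f) (Dom C f)" and h: "h \<in> hom C (Cod C f) (Dom C f)"
    using assms by (auto simp: inverse_pair_def Arr_in_hom)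
  have "g = Comp C g (Comp C f h)"
    using assms(2) Comp_Ident_right[OF g] by (simp add: inverse_pair_def)
  also have "\<dots> = Comp C (Comp C g f) h"
    by (rule Comp_assoc[OF h f g])
  also have "\<dots> = h"
    using assms(1) Comp_Ident_left[OF h] by (simp add: inverse_pair_def)
  finally show ?thesis .
qed

text \<open>Cancelling \<open>h\<close> on the left and \<open>f\<close> on the right of the square turns it around. This makes
  naturality at an invertible arrow imply naturality at its inverse.\<close>

lemma (in category) square_inverse:
  assumes fg: "inverse_pair C f g" and hk: "inverse_pair C h k"
    and s: "s \<in> hom C (Dom C f) (Dom C h)" and t: "t \<in> hom C (Cod C f) (Cod C h)"
    and square: "Comp C t f = Comp C h s"
  shows "Comp C s g = Comp C k t"
proof -
  have f: "f \<in> hom C (Dom C f) (Cod C f)" and g: "g \<in> hom C (Cod C f) (Dom C f)"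
    and h: "h \<in> hom C (Dom C h) (Cod C h)" and k: "k \<in> hom C (Cod C h) (Dom C h)"
    using fg hk by (auto simp: inverse_pair_def Arr_in_hom)
  have "Comp C s g = Comp C (Comp C (Comp C k h) s) g"
    using hk Comp_Ident_left[OF s] by (simp add: inverse_pair_def)
  also have "\<dots> = Comp C (Comp C k (Comp C t f)) g"
    using Comp_assoc[OF s h k] square by simp
  also have "\<dots> = Comp C k (Comp C t (Comp C f g))"
    using Comp_assoc[OF g Comp_in_hom[OF f t] k] Comp_assoc[OF g f t] by simp
  also have "\<dots> = Comp C k t"
    using fg Comp_Ident_right[OF t] by (simp add: inverse_pair_def)
  finally show ?thesis .
qed

lemma functor_hom:
  assumes "is_functor C D F" and "f \<in> hom C x y"
  shows "FArr F f \<in> hom D (FObj F x) (FObj F y)"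
  using assms by (auto simp: is_functor_def hom_def PiE_iff)

lemma functor_Comp:
  assumes "is_functor C D F" and "f \<in> hom C x y" and "g \<in> hom C y z"
  shows "FArr F (Comp C g f) = Comp D (FArr F g) (FArr F f)"
  using assms by (auto simp: is_functor_def hom_def)

lemma functor_Ident:
  "is_functor C D F \<Longrightarrow> x \<in> Obj C \<Longrightarrow> FArr F (Ident C x) = Ident D (FObj F x)"
  by (simp add: is_functor_def)

lemma functor_Obj: "is_functor C D F \<Longrightarrow> x \<in> Obj C \<Longrightarrow> FObj F x \<in> Obj D"
  by (auto simp: is_functor_def PiE_iff)

lemma (in category) functor_inverse_pair:
  assumes F: "is_functor C D F" and fg: "inverse_pair C f g"
  shows "inverse_pair D (FArr F f) (FArr F g)"
proof -
  have f: "f \<in> hom C (Dom C f) (Cod C f)" and g: "g \<in> hom C (Cod C f) (Dom C f)"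
    and gf: "Comp C g f = Ident C (Dom C f)" and fg': "Comp C f g = Ident C (Cod C f)"
    using fg by (auto simp: inverse_pair_def Arr_in_hom)
  have "Dom C f \<in> Obj C" "Cod C f \<in> Obj C"
    using f by (auto simp: hom_def Dom_in_Obj Cod_in_Obj)
  then show ?thesis
    using functor_hom[OF F f] functor_hom[OF F g] functor_Comp[OF F f g] functor_Comp[OF F g f]
    by (simp add: inverse_pair_def gf fg' functor_Ident[OF F]) (simp add: hom_def)
qed

lemma is_functor_comp_functor:
  assumes "category C" and F: "is_functor C B F" and G: "is_functor B D G"
  shows "is_functor C D (comp_functor C G F)"
proof -
  interpret category C by fact
  have FArr: "FArr F f \<in> hom B (FObj F (Dom C f)) (FObj F (Cod C f))" if "f \<in> Arr C" for f
    using functor_hom[OF F Arr_in_hom[OF that]] .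
  show ?thesis
    unfolding is_functor_def
  proof (intro conjI ballI impI)
    show "FObj (comp_functor C G F) \<in> Obj C \<rightarrow>\<^sub>E Obj D"
      using functor_Obj[OF G functor_Obj[OF F]] by (auto simp: comp_functor_def compose_def)
    show "FArr (comp_functor C G F) \<in> Arr C \<rightarrow>\<^sub>E Arr D"
      using functor_hom[OF G FArr] by (auto simp: comp_functor_def compose_def hom_def)
  next
    fix f assume f: "f \<in> Arr C"
    show "Dom D (FArr (comp_functor C G F) f) = FObj (comp_functor C G F) (Dom C f)"
      and "Cod D (FArr (comp_functor C G F) f) = FObj (comp_functor C G F) (Cod C f)"
      using functor_hom[OF G FArr[OF f]] f
      by (auto simp: comp_functor_def compose_def hom_def Dom_in_Obj Cod_in_Obj)
  next
    fix x assume x: "x \<in> Obj C"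
    then show "FArr (comp_functor C G F) (Ident C x) = Ident D (FObj (comp_functor C G F) x)"
      using Ident_in_hom[OF x] functor_Obj[OF F x]
      by (simp add: comp_functor_def compose_def hom_def functor_Ident[OF F] functor_Ident[OF G])
  next
    fix f g assume f: "f \<in> Arr C" and g: "g \<in> Arr C" and fg: "Cod C f = Dom C g"
    have "Comp C g f \<in> Arr C"
      using Comp_in_hom[of f "Dom C f" "Cod C f" g "Cod C g"] f g fg by (simp add: hom_def)
    moreover have "FArr F (Comp C g f) = Comp B (FArr F g) (FArr F f)"
      using F f g fg by (simp add: is_functor_def)
    ultimately show "FArr (comp_functor C G F) (Comp C g f) =
        Comp D (FArr (comp_functor C G F) g) (FArr (comp_functor C G F) f)"
      using f g fg functor_Comp[OF G FArr[OF f], of "FArr F g" "FObj F (Cod C g)"] FArr[OF g]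
      by (simp add: comp_functor_def compose_def)
  qed
qed

section \<open>The category of zigzags\<close>

locale category_with_weak_equivalences = category C
  for C :: "('o, 'm) cat" +
  fixes W :: "'m set"
  assumes W_Arr: "W \<subseteq> Arr C"
begin

abbreviation "H \<equiv> Ho C W"
abbreviation "L \<equiv> Ho_functor C W"
abbreviation zz where "zz \<equiv> zigzag C W"
abbreviation zz_eq where "zz_eq \<equiv> zigzag_eq C W"
abbreviation zz_class where "zz_class \<equiv> zigzag_class C W"

lemma zigzag_Obj: "zz x y p \<Longrightarrow> x \<in> Obj C \<and> y \<in> Obj C"
  by (induction rule: zigzag.induct) (use W_Arr Dom_in_Obj Cod_in_Obj in auto)

lemma zigzag_append: "zz x y p \<Longrightarrow> zz y z q \<Longrightarrow> zz x z (p @ q)"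
  by (induction rule: zigzag.induct) (auto intro: zigzag.intros)

lemma zigzag_Fwd: "f \<in> Arr C \<Longrightarrow> zz (Dom C f) (Cod C f) [Fwd f]"
  by (intro zigzag.intros Cod_in_Obj)

lemma zigzag_Fwd_hom: "f \<in> hom C x y \<Longrightarrow> zz x y [Fwd f]"
  using zigzag_Fwd by (auto simp: hom_def)

lemma zigzag_Rev: "w \<in> W \<Longrightarrow> zz (Cod C w) (Dom C w) [Rev w]"
  using W_Arr by (intro zigzag.intros Dom_in_Obj) auto

lemma zigzag_eq_imp_zigzag: "zz_eq x y p q \<Longrightarrow> zz x y p \<and> zz x y q"
proof (induction rule: zigzag_eq.induct)
  case (cong x' x a y p q y' b)
  then show ?case by (blast intro: zigzag_append)
next
  case (ident x)
  then show ?case by (simp add: zigzag.Empty zigzag_Fwd_hom Ident_in_hom)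
next
  case (comp f x y g z)
  then show ?case
    using zigzag_append[OF zigzag_Fwd_hom zigzag_Fwd_hom]
    by (fastforce intro: zigzag_Fwd_hom Comp_in_hom)
next
  case (fwd_rev w)
  then show ?case
    using zigzag_append[OF zigzag_Fwd zigzag_Rev, of w] W_Arr
    by (auto intro: zigzag_Fwd_hom Ident_in_hom Dom_in_Obj)
next
  case (rev_fwd w)
  then show ?case
    using zigzag_append[OF zigzag_Rev zigzag_Fwd, of w] W_Arr
    by (auto intro: zigzag_Fwd_hom Ident_in_hom Cod_in_Obj)
qed auto

lemma zigzag_eq_append:
  assumes "zz_eq x y p p'" and "zz_eq y z q q'"
  shows "zz_eq x z (p @ q) (p' @ q')"
proof -
  have "zz_eq x z ([] @ p @ q) ([] @ p' @ q)"
    using assms zigzag_eq_imp_zigzag zigzag_Obj by (meson zigzag.Empty zigzag_eq.cong)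
  moreover have "zz_eq x z (p' @ q @ []) (p' @ q' @ [])"
    using assms zigzag_eq_imp_zigzag zigzag_Obj by (meson zigzag.Empty zigzag_eq.cong)
  ultimately show ?thesis
    by (auto intro: zigzag_eq.trans)
qed

lemma zigzag_class_eqI: "zz_eq x y p q \<Longrightarrow> zz_class x y p = zz_class x y q"
  by (auto simp: zigzag_class_def intro: zigzag_eq.trans zigzag_eq.sym)

lemma zigzag_in_class: "zz x y p \<Longrightarrow> p \<in> zz_class x y p"
  by (simp add: zigzag_class_def zigzag_eq.refl)

lemma Ho_Obj: "Obj H = Obj C"
  by (simp add: Ho_def)

lemma Ho_Ident: "Ident H x = (x, zz_class x x [], x)"
  by (simp add: Ho_def)

lemma zigzag_Ho_hom: "zz x y p \<Longrightarrow> (x, zz_class x y p, y) \<in> hom H x y"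
  by (auto simp: Ho_def hom_def)

lemma Ho_homE:
  assumes "a \<in> hom H x y"
  obtains p where "zz x y p" and "a = (x, zz_class x y p, y)"
  using assms by (auto simp: Ho_def hom_def)

text \<open>Composition in the homotopy category is defined as a union over all pairs of representatives.
  The union is a single class because concatenation respects equivalence and classes are
  nonempty.\<close>

lemma Ho_Comp:
  assumes p: "zz x y p" and q: "zz y z q"
  shows "Comp H (y, zz_class y z q, z) (x, zz_class x y p, y) = (x, zz_class x z (p @ q), z)"
proof -
  have class_eq: "zz_class x z (p' @ q') = zz_class x z (p @ q)"
    if "p' \<in> zz_class x y p" and "q' \<in> zz_class y z q" for p' q'
    using that by (intro zigzag_class_eqI zigzag_eq_append)
      (auto simp: zigzag_class_def intro: zigzag_eq.sym)
  have "(\<Union>p' \<in> zz_class x y p. \<Union>q' \<in> zz_class y z q. zz_class x z (p' @ q')) =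
      (\<Union>p' \<in> zz_class x y p. \<Union>q' \<in> zz_class y z q. zz_class x z (p @ q))"
    by (intro SUP_cong HOL.refl class_eq)
  also have "\<dots> = zz_class x z (p @ q)"
    using zigzag_in_class[OF p] zigzag_in_class[OF q] by (simp add: ex_in_conv[symmetric]) blast
  finally show ?thesis
    by (simp add: Ho_def)
qed

lemma category_Ho: "category H"
proof
  fix a assume "a \<in> Arr H"
  then show "Dom H a \<in> Obj H" "Cod H a \<in> Obj H"
    using zigzag_Obj by (auto simp: Ho_def)
next
  fix x assume "x \<in> Obj H"
  then show "Ident H x \<in> hom H x x"
    by (simp add: Ho_Obj Ho_Ident zigzag_Ho_hom zigzag.Empty)
next
  fix a b x y z assume a: "a \<in> hom H x y" and b: "b \<in> hom H y z"
  show "Comp H b a \<in> hom H x z"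
    by (rule Ho_homE[OF a], rule Ho_homE[OF b]) (simp add: Ho_Comp zigzag_Ho_hom zigzag_append)
next
  fix a x y assume "a \<in> hom H x y"
  then obtain p where p: "zz x y p" and a: "a = (x, zz_class x y p, y)"
    by (rule Ho_homE)
  have "zz x x []" "zz y y []"
    using zigzag_Obj[OF p] by (auto intro: zigzag.Empty)
  then show "Comp H (Ident H y) a = a" "Comp H a (Ident H x) = a"
    using Ho_Comp[of x x "[]" y p] Ho_Comp[of x y p y "[]"] p by (simp_all add: Ho_Ident a)
next
  fix a b c x y z u
  assume a: "a \<in> hom H x y" and b: "b \<in> hom H y z" and c: "c \<in> hom H z u"
  show "Comp H c (Comp H b a) = Comp H (Comp H c b) a"
    by (rule Ho_homE[OF a], rule Ho_homE[OF b], rule Ho_homE[OF c])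
      (simp add: Ho_Comp zigzag_append)
qed

sublocale Ho: category H
  by (rule category_Ho)

lemma L_Obj: "x \<in> Obj C \<Longrightarrow> FObj L x = x"
  by (simp add: Ho_functor_def)

lemma L_Arr: "f \<in> Arr C \<Longrightarrow> FArr L f = (Dom C f, zz_class (Dom C f) (Cod C f) [Fwd f], Cod C f)"
  by (simp add: Ho_functor_def)

lemma functor_L: "is_functor C H L"
  unfolding is_functor_def
proof (intro conjI ballI impI)
  show "FObj L \<in> Obj C \<rightarrow>\<^sub>E Obj H"
    by (auto simp: Ho_functor_def Ho_Obj)
  show "FArr L \<in> Arr C \<rightarrow>\<^sub>E Arr H"
    using zigzag_Ho_hom[OF zigzag_Fwd] by (auto simp: Ho_functor_def hom_def)
next
  fix f assume f: "f \<in> Arr C"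
  then show "Dom H (FArr L f) = FObj L (Dom C f)" "Cod H (FArr L f) = FObj L (Cod C f)"
    by (simp_all add: L_Obj L_Arr Dom_in_Obj Cod_in_Obj) (simp_all add: Ho_def)
next
  fix x assume x: "x \<in> Obj C"
  then have "zz_class x x [Fwd (Ident C x)] = zz_class x x []"
    by (intro zigzag_class_eqI zigzag_eq.sym[OF zigzag_eq.ident])
  then show "FArr L (Ident C x) = Ident H (FObj L x)"
    using Ident_in_hom[OF x] x by (simp add: L_Obj L_Arr Ho_Ident hom_def)
next
  fix f g assume f: "f \<in> Arr C" and g: "g \<in> Arr C" and fg: "Cod C f = Dom C g"
  then have f': "f \<in> hom C (Dom C f) (Dom C g)" and g': "g \<in> hom C (Dom C g) (Cod C g)"
    by (auto simp: hom_def)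
  have "zz_class (Dom C f) (Cod C g) [Fwd f, Fwd g] =
      zz_class (Dom C f) (Cod C g) [Fwd (Comp C g f)]"
    by (intro zigzag_class_eqI zigzag_eq.comp[OF f' g'])
  then show "FArr L (Comp C g f) = Comp H (FArr L g) (FArr L f)"
    using Ho_Comp[OF zigzag_Fwd_hom[OF f'] zigzag_Fwd_hom[OF g']] Comp_in_hom[OF f' g'] f g fg
    by (simp add: L_Arr hom_def)
qed

definition reversal :: "'m \<Rightarrow> 'o \<times> 'm letter list set \<times> 'o" where
  "reversal w = (Cod C w, zz_class (Cod C w) (Dom C w) [Rev w], Dom C w)"

lemma inverse_pair_reversal:
  assumes w: "w \<in> W"
  shows "inverse_pair H (FArr L w) (reversal w)"
proof -
  let ?x = "Dom C w" and ?y = "Cod C w"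
  have wA: "w \<in> Arr C"
    using w W_Arr by auto
  then have x: "?x \<in> Obj C" and y: "?y \<in> Obj C"
    by (auto intro: Dom_in_Obj Cod_in_Obj)
  have "zz_class ?x ?x [Fwd w, Rev w] = zz_class ?x ?x []"
    and "zz_class ?y ?y [Rev w, Fwd w] = zz_class ?y ?y []"
    using zigzag_eq.trans[OF zigzag_eq.fwd_rev[OF w] zigzag_eq.sym[OF zigzag_eq.ident[OF x]]]
      zigzag_eq.trans[OF zigzag_eq.rev_fwd[OF w] zigzag_eq.sym[OF zigzag_eq.ident[OF y]]]
    by (simp_all add: zigzag_class_eqI)
  then have "Comp H (reversal w) (FArr L w) = Ident H ?x"
    and "Comp H (FArr L w) (reversal w) = Ident H ?y"
    using Ho_Comp[OF zigzag_Fwd[OF wA] zigzag_Rev[OF w]] Ho_Comp[OF zigzag_Rev[OF w] zigzag_Fwd[OF wA]] wA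
    by (simp_all add: L_Arr reversal_def Ho_Ident)
  moreover have "FArr L w \<in> hom H ?x ?y" "reversal w \<in> hom H ?y ?x"
    using zigzag_Ho_hom[OF zigzag_Fwd[OF wA]] zigzag_Ho_hom[OF zigzag_Rev[OF w]] wA
    by (simp_all add: L_Arr reversal_def)
  ultimately show ?thesis
    by (simp add: inverse_pair_def hom_def)
qed

lemma L_hom: "f \<in> Arr C \<Longrightarrow> FArr L f \<in> hom H (Dom C f) (Cod C f)"
  by (simp add: L_Arr zigzag_Ho_hom zigzag_Fwd)

lemma reversal_hom: "w \<in> W \<Longrightarrow> reversal w \<in> hom H (Cod C w) (Dom C w)"
  by (simp add: reversal_def zigzag_Ho_hom zigzag_Rev)

text \<open>The homotopy category is generated under composition by the image of the localization functor
  and the formal inverses of weak equivalences: a zigzag is the composite of its letters.\<close>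

lemma Ho_arrow_induct [consumes 1, case_names Ident Fwd Rev Comp]:
  assumes "a \<in> hom H x y"
    and Ident: "\<And>x. x \<in> Obj C \<Longrightarrow> P x x (Ident H x)"
    and Fwd: "\<And>f. f \<in> Arr C \<Longrightarrow> P (Dom C f) (Cod C f) (FArr L f)"
    and Rev: "\<And>w. w \<in> W \<Longrightarrow> P (Cod C w) (Dom C w) (reversal w)"
    and Comp: "\<And>a b x y z. a \<in> hom H x y \<Longrightarrow> b \<in> hom H y z \<Longrightarrow> P x y a \<Longrightarrow> P y z b \<Longrightarrow>
      P x z (Comp H b a)"
  shows "P x y a"
proof -
  have "P x y (x, zz_class x y p, y)" if "zz x y p" for p
    using that
  proof (induction rule: zigzag.induct)
    case (Empty x)
    then show ?case using Ident by (simp add: Ho_Ident)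
  next
    case (Fwd f y p)
    show ?case
      using Comp[OF L_hom zigzag_Ho_hom assms(3)] Fwd Ho_Comp[OF zigzag_Fwd]
      by (fastforce simp: L_Arr)
  next
    case (Rev w y p)
    show ?case
      using Comp[OF reversal_hom zigzag_Ho_hom assms(4)] Rev Ho_Comp[OF zigzag_Rev]
      by (fastforce simp: reversal_def)
  qed
  then show ?thesis
    using assms(1) by (auto elim: Ho_homE)
qed

section \<open>Extending functors along the localization\<close>

lemma comp_functor_L_Obj: "x \<in> Obj C \<Longrightarrow> FObj (comp_functor C G L) x = FObj G x"
  by (simp add: comp_functor_def compose_def L_Obj)

lemma comp_functor_L_Arr: "f \<in> Arr C \<Longrightarrow> FArr (comp_functor C G L) f = FArr G (FArr L f)"
  by (simp add: comp_functor_def compose_def)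

text \<open>Functors preserve inverses and inverses are unique, so two functors that agree on \<open>L w\<close> also
  agree on its inverse, and hence on all generators.\<close>

lemma functor_from_Ho_unique:
  assumes "category D" and G: "is_functor H D G" and K: "is_functor H D K"
    and GK: "comp_functor C G L = comp_functor C K L"
  shows "G = K"
proof -
  interpret D: category D by fact
  have Obj: "FObj G x = FObj K x" if "x \<in> Obj C" for x
    using comp_functor_L_Obj[OF that] GK by metis
  have L: "FArr G (FArr L f) = FArr K (FArr L f)" if "f \<in> Arr C" for f
    using comp_functor_L_Arr[OF that] GK by metis
  have Arr: "FArr G a = FArr K a" if "a \<in> hom H x y" for a x y
    using that
  proof (induction rule: Ho_arrow_induct)
    case (Ident x)
    then show ?case
      by (simp add: functor_Ident[OF G] functor_Ident[OF K] Ho_Obj Obj)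
  next
    case (Fwd f)
    then show ?case by (rule L)
  next
    case (Rev w)
    then have "inverse_pair D (FArr G (FArr L w)) (FArr G (reversal w))"
      and "inverse_pair D (FArr K (FArr L w)) (FArr K (reversal w))"
      by (simp_all add: Ho.functor_inverse_pair[OF G] Ho.functor_inverse_pair[OF K]
          inverse_pair_reversal)
    with Rev W_Arr show ?case
      using L by (metis D.inverse_pair_unique subsetD)
  next
    case (Comp a b x y z)
    then show ?case
      by (simp add: functor_Comp[OF G] functor_Comp[OF K])
  qed
  have "FObj G = FObj K"
    by (rule extensionalityI[where A = "Obj C"])
      (use G K Obj in \<open>auto simp: is_functor_def Ho_Obj PiE_iff\<close>)
  moreover have "FArr G = FArr K"
    by (rule extensionalityI[where A = "Arr H"])
      (use G K Arr[OF Arr_in_hom] in \<open>auto simp: is_functor_def PiE_iff\<close>)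
  ultimately show ?thesis by simp
qed

end

definition chosen_inverse :: "('p, 'n) cat \<Rightarrow> 'n \<Rightarrow> 'n" where
  "chosen_inverse D f = (SOME g. inverse_pair D f g)"

lemma inverse_pair_chosen_inverse: "is_iso D f \<Longrightarrow> inverse_pair D f (chosen_inverse D f)"
  unfolding chosen_inverse_def is_iso_iff_inverse_pair by (rule someI_ex)

primrec letter_value :: "('p, 'n) cat \<Rightarrow> ('o, 'm, 'p, 'n) ftor \<Rightarrow> 'm letter \<Rightarrow> 'n" where
  "letter_value D F (Fwd f) = FArr F f"
| "letter_value D F (Rev w) = chosen_inverse D (FArr F w)"

text \<open>The target object is an argument because the empty string does not determine the
  object at whose identity it stands.\<close>

primrec zigzag_value ::
  "('p, 'n) cat \<Rightarrow> ('o, 'm, 'p, 'n) ftor \<Rightarrow> 'o \<Rightarrow> 'm letter list \<Rightarrow> 'n" where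
  "zigzag_value D F y [] = Ident D (FObj F y)"
| "zigzag_value D F y (l # p) = Comp D (zigzag_value D F y p) (letter_value D F l)"

locale inverting_functor = category_with_weak_equivalences C W + D: category D
  for C :: "('o, 'm) cat" and W and D :: "('p, 'n) cat" +
  fixes F :: "('o, 'm, 'p, 'n) ftor"
  assumes functor_F: "is_functor C D F"
    and F_inverts: "w \<in> W \<Longrightarrow> is_iso D (FArr F w)"
begin

abbreviation "letter_val \<equiv> letter_value D F"
abbreviation "val \<equiv> zigzag_value D F"

lemma F_Obj: "x \<in> Obj C \<Longrightarrow> FObj F x \<in> Obj D"
  by (rule functor_Obj[OF functor_F])

lemma F_Arr: "f \<in> Arr C \<Longrightarrow> FArr F f \<in> hom D (FObj F (Dom C f)) (FObj F (Cod C f))"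
  by (rule functor_hom[OF functor_F Arr_in_hom])

lemma inverse_pair_Rev: "w \<in> W \<Longrightarrow> inverse_pair D (FArr F w) (letter_val (Rev w))"
  by (simp add: inverse_pair_chosen_inverse F_inverts)

lemma letter_value_Rev_hom:
  assumes "w \<in> W"
  shows "letter_val (Rev w) \<in> hom D (FObj F (Cod C w)) (FObj F (Dom C w))"
proof -
  have "w \<in> Arr C"
    using assms W_Arr by auto
  then show ?thesis
    using inverse_pair_Rev[OF assms] F_Arr[of w]
    by (simp add: inverse_pair_def hom_def)
qed

lemma zigzag_value_hom: "zz x y p \<Longrightarrow> val y p \<in> hom D (FObj F x) (FObj F y)"
proof (induction rule: zigzag.induct)
  case (Empty x)
  then show ?case by (simp add: D.Ident_in_hom F_Obj)
next
  case (Fwd f y p)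
  then show ?case using D.Comp_in_hom[OF F_Arr] by simp
next
  case (Rev w y p)
  then show ?case using D.Comp_in_hom[OF letter_value_Rev_hom] by simp
qed

lemma zigzag_value_append:
  assumes "zz x y p" and q: "zz y z q"
  shows "val z (p @ q) = Comp D (val z q) (val y p)"
  using assms
proof (induction rule: zigzag.induct)
  case (Empty x)
  then show ?case using D.Comp_Ident_right[OF zigzag_value_hom] by simp
next
  case (Fwd f y p)
  then show ?case
    using D.Comp_assoc[OF F_Arr zigzag_value_hom zigzag_value_hom] by simp
next
  case (Rev w y p)
  then show ?case
    using D.Comp_assoc[OF letter_value_Rev_hom zigzag_value_hom zigzag_value_hom] by simp
qed

lemma zigzag_value_Fwd: "f \<in> Arr C \<Longrightarrow> val (Cod C f) [Fwd f] = FArr F f"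
  using D.Comp_Ident_left[OF F_Arr] by simp

lemma zigzag_value_Fwd_hom: "f \<in> hom C x y \<Longrightarrow> val y [Fwd f] = FArr F f"
  using zigzag_value_Fwd by (auto simp: hom_def)

lemma zigzag_value_Rev: "w \<in> W \<Longrightarrow> val (Dom C w) [Rev w] = letter_val (Rev w)"
  using D.Comp_Ident_left[OF letter_value_Rev_hom] by simp

text \<open>The value descends to equivalence classes: functoriality of \<open>F\<close> gives the relations for identities
  and composites, the choice of inverses gives the two cancellation relations, and compatibility
  with concatenation gives closure under contexts.\<close>

lemma zigzag_value_eq: "zz_eq x y p q \<Longrightarrow> val y p = val y q"
proof (induction rule: zigzag_eq.induct)
  case (cong x' x a y p q y' b)
  have "val y' (a @ r @ b) = Comp D (Comp D (val y' b) (val y r)) (val x a)" if "zz x y r" for r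
    using zigzag_value_append[OF cong(1) zigzag_append[OF that cong(3)]]
      zigzag_value_append[OF that cong(3)] by simp
  then show ?case
    using zigzag_eq_imp_zigzag[OF cong(2)] cong.IH by simp
next
  case (ident x)
  then show ?case
    using zigzag_value_Fwd_hom[OF Ident_in_hom[OF ident]] functor_Ident[OF functor_F ident] by simp
next
  case (comp f x y g z)
  have "val z ([Fwd f] @ [Fwd g]) = Comp D (FArr F g) (FArr F f)"
    using zigzag_value_append[OF zigzag_Fwd_hom[OF comp(1)] zigzag_Fwd_hom[OF comp(2)]]
      zigzag_value_Fwd_hom[OF comp(1)] zigzag_value_Fwd_hom[OF comp(2)] by simp
  then show ?case
    using functor_Comp[OF functor_F comp] zigzag_value_Fwd_hom[OF Comp_in_hom[OF comp]] by simp
next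
  case (fwd_rev w)
  then have w: "w \<in> Arr C" and x: "Dom C w \<in> Obj C"
    using W_Arr by (auto intro: Dom_in_Obj)
  have "val (Dom C w) ([Fwd w] @ [Rev w]) = Ident D (FObj F (Dom C w))"
    using zigzag_value_append[OF zigzag_Fwd[OF w] zigzag_Rev[OF fwd_rev]]
      zigzag_value_Fwd[OF w] zigzag_value_Rev[OF fwd_rev] inverse_pair_Rev[OF fwd_rev] F_Arr[OF w]
    by (simp add: inverse_pair_def hom_def)
  then show ?case
    using zigzag_value_Fwd_hom[OF Ident_in_hom[OF x]] functor_Ident[OF functor_F x] by simp
next
  case (rev_fwd w)
  then have w: "w \<in> Arr C" and y: "Cod C w \<in> Obj C"
    using W_Arr by (auto intro: Cod_in_Obj)
  have "val (Cod C w) ([Rev w] @ [Fwd w]) = Ident D (FObj F (Cod C w))"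
    using zigzag_value_append[OF zigzag_Rev[OF rev_fwd] zigzag_Fwd[OF w]]
      zigzag_value_Fwd[OF w] zigzag_value_Rev[OF rev_fwd] inverse_pair_Rev[OF rev_fwd] F_Arr[OF w]
    by (simp add: inverse_pair_def hom_def)
  then show ?case
    using zigzag_value_Fwd_hom[OF Ident_in_hom[OF y]] functor_Ident[OF functor_F y] by simp
qed auto

definition extension :: "('o, 'o \<times> 'm letter list set \<times> 'o, 'p, 'n) ftor" where
  "extension =
    \<lparr>FObj = FObj F, FArr = (\<lambda>(x, c, y) \<in> Arr H. val y (SOME p. p \<in> c))\<rparr>"

lemma extension_class:
  assumes p: "zz x y p"
  shows "FArr extension (x, zz_class x y p, y) = val y p"
proof -
  have "(SOME q. q \<in> zz_class x y p) \<in> zz_class x y p"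
    using zigzag_in_class[OF p] by (rule someI)
  then have "val y p = val y (SOME q. q \<in> zz_class x y p)"
    by (intro zigzag_value_eq) (simp add: zigzag_class_def)
  then show ?thesis
    using zigzag_Ho_hom[OF p] by (simp add: extension_def hom_def)
qed

text \<open>Functoriality is compatibility of the value with concatenation, read on classes.\<close>

lemma functor_extension: "is_functor H D extension"
  unfolding is_functor_def
proof (intro conjI ballI impI)
  have hom_xy: "FArr extension a \<in> hom D (FObj F x) (FObj F y)" if "a \<in> hom H x y" for a x y
    by (rule Ho_homE[OF that]) (simp add: extension_class zigzag_value_hom)
  note hom = hom_xy[OF Arr_in_hom]
  show "FObj extension \<in> Obj H \<rightarrow>\<^sub>E Obj D"
    using functor_F by (simp add: extension_def Ho_Obj is_functor_def)
  show "FArr extension \<in> Arr H \<rightarrow>\<^sub>E Arr D"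
    using hom by (auto simp: hom_def extension_def)
  show "Dom D (FArr extension a) = FObj extension (Dom H a)"
    and "Cod D (FArr extension a) = FObj extension (Cod H a)" if "a \<in> Arr H" for a
    using hom[OF that] by (simp_all add: hom_def) (simp_all add: extension_def)
  show "FArr extension (Ident H x) = Ident D (FObj extension x)" if "x \<in> Obj H" for x
    using that extension_class[OF zigzag.Empty, of x]
    by (simp add: Ho_Ident Ho_Obj) (simp add: extension_def)
next
  fix a b assume a: "a \<in> Arr H" and b: "b \<in> Arr H" and ab: "Cod H a = Dom H b"
  obtain x y p where p: "zz x y p" "a = (x, zz_class x y p, y)"
    by (rule Ho_homE[OF Arr_in_hom[OF a]]) (rule that, auto simp: Ho_def)
  obtain y' z q where q: "zz y' z q" "b = (y', zz_class y' z q, z)"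
    by (rule Ho_homE[OF Arr_in_hom[OF b]]) (rule that, auto simp: Ho_def)
  have "y' = y"
    using ab p q by (simp add: Ho_def)
  then show "FArr extension (Comp H b a) = Comp D (FArr extension b) (FArr extension a)"
    using p q by (simp add: Ho_Comp extension_class zigzag_append zigzag_value_append)
qed

lemma extension_L: "comp_functor C extension L = F"
proof -
  have "FObj (comp_functor C extension L) = FObj F"
  proof (rule extensionalityI)
    show "FObj (comp_functor C extension L) \<in> extensional (Obj C)"
      by (simp add: comp_functor_def)
    show "FObj F \<in> extensional (Obj C)"
      using functor_F by (simp add: is_functor_def PiE_iff)
  qed (simp add: comp_functor_L_Obj extension_def)
  moreover have "FArr (comp_functor C extension L) = FArr F"
  proof (rule extensionalityI)
    show "FArr (comp_functor C extension L) \<in> extensional (Arr C)"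
      by (simp add: comp_functor_def)
    show "FArr F \<in> extensional (Arr C)"
      using functor_F by (simp add: is_functor_def PiE_iff)
  next
    fix f assume "f \<in> Arr C"
    then show "FArr (comp_functor C extension L) f = FArr F f"
      using extension_class[OF zigzag_Fwd] zigzag_value_Fwd
      by (simp add: comp_functor_L_Arr L_Arr)
  qed
  ultimately show ?thesis by simp
qed

end

section \<open>The localization theorem\<close>

context category_with_weak_equivalences
begin

lemma strong_localization_Ho: "strong_localization TYPE('d) TYPE('e) C W H L"
  unfolding strong_localization_def
proof (intro conjI ballI allI impI)
  show "category C" "W \<subseteq> Arr C" "category H" "is_functor C H L"
    using category_axioms W_Arr category_Ho functor_L by auto
  show "is_iso H (FArr L w)" if "w \<in> W" for w
    using inverse_pair_reversal[OF that] unfolding is_iso_iff_inverse_pair by (rule exI)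
next
  fix D :: "('d, 'e) cat" and F
  assume *: "category D \<and> is_functor C D F \<and> (\<forall>w \<in> W. is_iso D (FArr F w))"
  then interpret D: category D by simp
  interpret inverting_functor C W D F
    by unfold_locales (use * in auto)
  show "\<exists>!G. is_functor H D G \<and> F = comp_functor C G L"
    using functor_extension extension_L functor_from_Ho_unique[OF D.category_axioms] by metis
qed

text \<open>The same family \<open>t\<close> appears on both sides because the localization functor is the identity on
  objects. Passing from right to left, naturality has to be extended from the image of \<open>L\<close> to every
  arrow of the homotopy category, which the generation principle makes possible.\<close>

lemma nattrans_Ho_iff:
  assumes "category D" and F: "is_functor H D F" and G: "is_functor H D G"
  shows "is_nattrans H D \<lparr>NDom = F, NCod = G, NComp = t\<rparr> \<longleftrightarrow>
    is_nattrans C D \<lparr>NDom = comp_functor C F L, NCod = comp_functor C G L, NComp = t\<rparr>"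
    (is "?H \<longleftrightarrow> ?C")
proof
  assume ?H
  have "is_functor C D (comp_functor C F L)" "is_functor C D (comp_functor C G L)"
    using is_functor_comp_functor[OF category_axioms functor_L] F G by auto
  moreover have "Comp D (t (Cod C f)) (FArr F (FArr L f)) =
      Comp D (FArr G (FArr L f)) (t (Dom C f))" if "f \<in> Arr C" for f
    using \<open>?H\<close> L_hom[OF that] by (auto simp: is_nattrans_def hom_def)
  ultimately show ?C
    using \<open>?H\<close> by (auto simp: is_nattrans_def Ho_Obj comp_functor_L_Obj comp_functor_L_Arr)
next
  assume ?C
  interpret D: category D by fact
  have t: "t x \<in> hom D (FObj F x) (FObj G x)" if "x \<in> Obj C" for x
    using \<open>?C\<close> that by (auto simp: is_nattrans_def comp_functor_L_Obj)
  have natural_L: "Comp D (t (Cod C f)) (FArr F (FArr L f)) =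
      Comp D (FArr G (FArr L f)) (t (Dom C f))" if "f \<in> Arr C" for f
    using \<open>?C\<close> that by (auto simp: is_nattrans_def comp_functor_L_Arr)
  \<comment> \<open>The endpoints are carried along in the induction because the components of \<open>t\<close> can be
    composed only at objects of \<open>C\<close>.\<close>
  have "x \<in> Obj C \<and> y \<in> Obj C \<and> Comp D (t y) (FArr F a) = Comp D (FArr G a) (t x)"
    if "a \<in> hom H x y" for a x y
    using that
  proof (induction rule: Ho_arrow_induct)
    case (Ident x)
    then show ?case
      using D.Comp_Ident_left[OF t] D.Comp_Ident_right[OF t]
      by (simp add: functor_Ident[OF F] functor_Ident[OF G] Ho_Obj)
  next
    case (Fwd f)
    then show ?case by (simp add: natural_L Dom_in_Obj Cod_in_Obj)
  next
    case (Rev w)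
    then have w: "w \<in> Arr C" and x: "Dom C w \<in> Obj C" and y: "Cod C w \<in> Obj C"
      using W_Arr by (auto intro: Dom_in_Obj Cod_in_Obj)
    have "Comp D (t (Dom C w)) (FArr F (reversal w)) =
        Comp D (FArr G (reversal w)) (t (Cod C w))"
    proof (rule D.square_inverse)
      show "inverse_pair D (FArr F (FArr L w)) (FArr F (reversal w))"
        and "inverse_pair D (FArr G (FArr L w)) (FArr G (reversal w))"
        using inverse_pair_reversal[OF Rev] Ho.functor_inverse_pair[OF F]
          Ho.functor_inverse_pair[OF G] by simp_all
      show "t (Dom C w) \<in> hom D (Dom D (FArr F (FArr L w))) (Dom D (FArr G (FArr L w)))"
        and "t (Cod C w) \<in> hom D (Cod D (FArr F (FArr L w))) (Cod D (FArr G (FArr L w)))"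
        using t[OF x] t[OF y] functor_hom[OF F L_hom[OF w]] functor_hom[OF G L_hom[OF w]]
        by (simp_all add: hom_def)
    qed (rule natural_L[OF w])
    with x y show ?case by simp
  next
    case (Comp a b x y z)
    then have x: "x \<in> Obj C" and y: "y \<in> Obj C" and z: "z \<in> Obj C" by auto
    note Fa = functor_hom[OF F Comp(1)] and Fb = functor_hom[OF F Comp(2)]
    note Ga = functor_hom[OF G Comp(1)] and Gb = functor_hom[OF G Comp(2)]
    have "Comp D (t z) (Comp D (FArr F b) (FArr F a)) =
        Comp D (Comp D (FArr G b) (FArr G a)) (t x)"
      using D.Comp_assoc[OF Fa Fb t[OF z]] D.Comp_assoc[OF Fa t[OF y] Gb]
        D.Comp_assoc[OF t[OF x] Ga Gb] Comp by simp
    then show ?case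
      using x z functor_Comp[OF F Comp(1,2)] functor_Comp[OF G Comp(1,2)] by simp
  qed
  then have "Comp D (t (Cod H a)) (FArr F a) = Comp D (FArr G a) (t (Dom H a))" if "a \<in> Arr H" for a
    using Arr_in_hom[OF that] by blast
  with \<open>?C\<close> t F G show ?H
    by (auto simp: is_nattrans_def Ho_Obj)
qed

text \<open>With source and target fixed, a transformation is its family of components. In this form the
  two hom sets compared by precomposition are indexed by the same families.\<close>

lemma hom_Fun_cat_eq:
  assumes "is_functor B D F" and "is_functor B D G"
  shows "hom (Fun_cat B D) F G =
    {\<lparr>NDom = F, NCod = G, NComp = t\<rparr> | t. is_nattrans B D \<lparr>NDom = F, NCod = G, NComp = t\<rparr>}"
proof (intro set_eqI iffI)
  fix s assume "s \<in> hom (Fun_cat B D) F G"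
  moreover obtain F' G' t where "s = \<lparr>NDom = F', NCod = G', NComp = t\<rparr>"
    by (cases s)
  ultimately show "s \<in> {\<lparr>NDom = F, NCod = G, NComp = t\<rparr> | t.
      is_nattrans B D \<lparr>NDom = F, NCod = G, NComp = t\<rparr>}"
    by (auto simp: hom_def Fun_cat_def)
qed (auto simp: hom_def Fun_cat_def)

lemma fully_faithful_precomp_Ho:
  assumes "category D"
  shows "fully_faithful (Fun_cat H D) (Fun_cat C D) (precomp_functor C H D L)"
  unfolding fully_faithful_def
proof (intro ballI)
  fix F G assume "F \<in> Obj (Fun_cat H D)" and "G \<in> Obj (Fun_cat H D)"
  then have F: "is_functor H D F" and G: "is_functor H D G"
    by (auto simp: Fun_cat_def)
  have FL: "is_functor C D (comp_functor C F L)" and GL: "is_functor C D (comp_functor C G L)"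
    using is_functor_comp_functor[OF category_axioms functor_L] F G by auto
  have Obj: "FObj (precomp_functor C H D L) F = comp_functor C F L"
    "FObj (precomp_functor C H D L) G = comp_functor C G L"
    using F G by (simp_all add: precomp_functor_def Fun_cat_def)
  have Arr: "FArr (precomp_functor C H D L) \<lparr>NDom = F, NCod = G, NComp = t\<rparr> =
      \<lparr>NDom = comp_functor C F L, NCod = comp_functor C G L, NComp = t\<rparr>"
    if t: "is_nattrans H D \<lparr>NDom = F, NCod = G, NComp = t\<rparr>" for t
  proof -
    have "compose (Obj C) t (FObj L) = t"
    proof (rule extensionalityI)
      show "t \<in> extensional (Obj C)"
        using t by (simp add: is_nattrans_def Ho_Obj)
    qed (simp_all add: compose_def L_Obj)
    then show ?thesis
      using t by (simp add: precomp_functor_def Fun_cat_def)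
  qed
  show "bij_betw (FArr (precomp_functor C H D L)) (hom (Fun_cat H D) F G)
      (hom (Fun_cat C D) (FObj (precomp_functor C H D L) F) (FObj (precomp_functor C H D L) G))"
    unfolding Obj hom_Fun_cat_eq[OF F G] hom_Fun_cat_eq[OF FL GL]
      nattrans_Ho_iff[OF assms F G, symmetric]
    by (rule bij_betwI') (use Arr in auto)
qed

theorem strict_localization_Ho: "strict_localization TYPE('d) TYPE('e) C W H L"
  unfolding strict_localization_def
  using strong_localization_Ho fully_faithful_precomp_Ho by blast

end

theorem theorem3:
  fixes M :: "('o, 'm) cat" and W Cof Fib :: "'m set"
  assumes "model_category M W Cof Fib"
  shows "strict_localization TYPE('d) TYPE('e) M W (Ho M W) (Ho_functor M W)"
proof -
  interpret model_category M W Cof Fib by fact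
  interpret category_with_weak_equivalences M W
    by unfold_locales (rule W_Arr)
  show ?thesis by (rule strict_localization_Ho)
qed

end
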